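(* Every $\mathcal{PCO}_{\sigma}$ formula $\varphi$ is equivalent to a $\mathcal{PCO}_{\sigma}$ formula $\varphi'$ such that: (A) all consequents of $\mathrel{\Box\!\!\rightarrow}$ are probabilistic atoms; (B) all consequents of $\supset$ are counterfactuals (formulas of the form $\mathbf X=\mathbf x\mathrel{\Box\!\!\rightarrow}\psi$) or probabilistic atoms. Consequently every $\mathcal{PCO}$ formula is a Boolean combination (using $\land,\sqcup$) of formulas of the forms $\gamma\supset\Pr(\alpha)\vartriangleright t$, $\mathbf X=\mathbf x\mathrel{\Box\!\!\rightarrow}\Pr(\alpha)\vartriangleright t$, and $\gamma\supset(\mathbf X=\mathbf x\mathrel{\Box\!\!\rightarrow}\Pr(\alpha)\vartriangleright t)$, where $\vartriangleright$ is $\geq$ or $>$ and $t$ is a rational $\epsilon\in[0,1]$ or $\Pr(\beta)$.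
   Context: A signature $\sigma=(Dom,Ran)$ is a finite set $Dom$ of variables, each with a finite range. A causal multiteam $T=(T^-,\mathcal{F})$ of signature $\sigma$ consists of a finite multiset $T^-$ of assignments over $Dom$ and a function component $\mathcal{F}$ giving, for each endogenous variable $Y$, a non-constant function $\mathcal{F}_Y$ of the remaining variables, with every row of $T^-$ compatible with these equations; $T$ is recursive (acyclic causal graph). For a consistent conjunction $\mathbf X=\mathbf x$, $T_{\mathbf X=\mathbf x}$ is obtained by setting $\mathbf X$ to $\mathbf x$ in each row, recomputing descendants via $\mathcal{F}$, and removing the equations for $\mathbf X$. $\mathcal{CO}$: $\alpha ::= Y=y \mid Y\neq y \mid \alpha\land\alpha \mid \alpha\lor\alpha \mid \alpha\supset\alpha \mid \mathbf X=\mathbf x \mathrel{\Box\!\!\rightarrow} \alpha$ (the last being the interventionist counterfactual). $\mathcal{PCO}$: $\varphi ::= \eta \mid \varphi\land\varphi \mid \varphi\sqcup\varphi \mid \alpha\supset\varphi \mid \mathbf X=\mathbf x\mathrel{\Box\!\!\rightarrow}\varphi$ with $\alpha\in\mathcal{CO}$, and atoms $\eta$ being literals $Y=y$, $Y\neq y$ or probabilistic atoms $\Pr(\alpha)\geq\epsilon$, $\Pr(\alpha)>\epsilon$, $\Pr(\alpha)\geq\Pr(\beta)$, $\Pr(\alpha)>\Pr(\beta)$ ($\alpha,\beta\in\mathcal{CO}$, $\epsilon\in[0,1]\cap\mathbb Q$). Semantics: literals hold if all rows satisfy them; $\land$ conjunction; $\sqcup$ is Boolean disjunction ($T\models\psi\sqcup\chi$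 iff $T\models\psi$ or $T\models\chi$); $T\models\alpha\supset\varphi$ iff $T^\alpha\models\varphi$, where $T^\alpha$ keeps the rows $s$ with $(\{s\},\mathcal{F})\models\alpha$; $T\models\mathbf X=\mathbf x\mathrel{\Box\!\!\rightarrow}\varphi$ iff $T_{\mathbf X=\mathbf x}\models\varphi$ or $\mathbf X=\mathbf x$ is inconsistent; a probabilistic atom holds iff $T$ is empty or the inequality holds for $P_T(\alpha)=|(T^\alpha)^-|/|T^-|$. Equivalence means satisfaction by the same causal multiteams. *)

theory Defs
  imports Complex_Main "HOL-Library.Multiset" "HOL-Library.FuncSet"
begin

section \<open>Causal multiteams\<close>

record ('v, 'd) signature =
  Dom :: "'v set"
  Ran :: "'v \<Rightarrow> 'd set"

definition is_signature :: "('v, 'd) signature \<Rightarrow> bool" where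
  "is_signature \<sigma> \<longleftrightarrow> finite (Dom \<sigma>) \<and> (\<forall>V\<in>Dom \<sigma>. finite (Ran \<sigma> V))"

type_synonym ('v, 'd) assignment = "'v \<Rightarrow> 'd"

definition assignments_on :: "('v, 'd) signature \<Rightarrow> 'v set \<Rightarrow> ('v, 'd) assignment set" where
  "assignments_on \<sigma> W = PiE W (Ran \<sigma>)"

text \<open>
  The function component is a partial map; its domain is the set of endogenous variables.
  The function attached to an endogenous variable \<open>Y\<close> takes an assignment to the
  remaining variables \<open>Dom \<sigma> - {Y}\<close>.
\<close>

type_synonym ('v, 'd) equations = "'v \<Rightarrow> (('v, 'd) assignment \<Rightarrow> 'd) option"

record ('v, 'd) cmteam =
  rows :: "('v, 'd) assignment multiset"
  eqs :: "('v, 'd) equations"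

definition apply_eq ::
  "('v, 'd) signature \<Rightarrow> ('v, 'd) equations \<Rightarrow> 'v \<Rightarrow> ('v, 'd) assignment \<Rightarrow> 'd" where
  "apply_eq \<sigma> F Y s = the (F Y) (restrict s (Dom \<sigma> - {Y}))"

definition is_function_component ::
  "('v, 'd) signature \<Rightarrow> ('v, 'd) equations \<Rightarrow> bool" where
  "is_function_component \<sigma> F \<longleftrightarrow>
     dom F \<subseteq> Dom \<sigma> \<and>
     (\<forall>Y f. F Y = Some f \<longrightarrow>
        f \<in> assignments_on \<sigma> (Dom \<sigma> - {Y}) \<rightarrow>\<^sub>E Ran \<sigma> Y \<and>
        (\<exists>w\<in>assignments_on \<sigma> (Dom \<sigma> - {Y}).
         \<exists>w'\<in>assignments_on \<sigma> (Dom \<sigma> - {Y}). f w \<noteq> f w'))"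

text \<open>
  There is an edge from \<open>X\<close> to \<open>Y\<close> when the function for \<open>Y\<close> really depends on its
  argument \<open>X\<close>.
\<close>

definition causal_graph ::
  "('v, 'd) signature \<Rightarrow> ('v, 'd) equations \<Rightarrow> ('v \<times> 'v) set" where
  "causal_graph \<sigma> F =
     {(X, Y). X \<in> Dom \<sigma> - {Y} \<and>
        (\<exists>f. F Y = Some f \<and>
          (\<exists>w\<in>assignments_on \<sigma> (Dom \<sigma> - {Y}).
           \<exists>w'\<in>assignments_on \<sigma> (Dom \<sigma> - {Y}).
             (\<forall>Z. Z \<noteq> X \<longrightarrow> w Z = w' Z) \<and> f w \<noteq> f w'))}"

definition is_causal_multiteam :: "('v, 'd) signature \<Rightarrow> ('v, 'd) cmteam \<Rightarrow> bool" where
  "is_causal_multiteam \<sigma> T \<longleftrightarrow>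
     is_function_component \<sigma> (eqs T) \<and>
     (\<forall>s\<in>#rows T. s \<in> assignments_on \<sigma> (Dom \<sigma>) \<and>
        (\<forall>Y\<in>dom (eqs T). s Y = apply_eq \<sigma> (eqs T) Y s)) \<and>
     acyclic (causal_graph \<sigma> (eqs T))"

section \<open>Interventions\<close>

text \<open>
  A conjunction \<open>X\<^sub>1 = x\<^sub>1 \<and> \<dots> \<and> X\<^sub>n = x\<^sub>n\<close> is a nonempty list of pairs.  A variable may occur
  several times; the conjunction is inconsistent if it occurs with two different values.
\<close>

type_synonym ('v, 'd) conjunction = "('v \<times> 'd) list"

definition is_conjunction :: "('v, 'd) signature \<Rightarrow> ('v, 'd) conjunction \<Rightarrow> bool" where
  "is_conjunction \<sigma> xs \<longleftrightarrow>
     xs \<noteq> [] \<and> (\<forall>(X, x)\<in>set xs. X \<in> Dom \<sigma> \<and> x \<in> Ran \<sigma> X)"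

definition consistent :: "('v, 'd) conjunction \<Rightarrow> bool" where
  "consistent xs \<longleftrightarrow> (\<forall>X x x'. (X, x) \<in> set xs \<longrightarrow> (X, x') \<in> set xs \<longrightarrow> x = x')"

definition descendants ::
  "('v, 'd) signature \<Rightarrow> ('v, 'd) equations \<Rightarrow> 'v set \<Rightarrow> 'v set" where
  "descendants \<sigma> F A = (causal_graph \<sigma> F)\<^sup>+ `` A"

text \<open>
  The updated row is the solution of the recomputed equations, which is unique because the
  causal graph is acyclic.
\<close>

definition intervene_row ::
  "('v, 'd) signature \<Rightarrow> ('v, 'd) equations \<Rightarrow> ('v, 'd) conjunction \<Rightarrow>
   ('v, 'd) assignment \<Rightarrow> ('v, 'd) assignment" where
  "intervene_row \<sigma> F xs s =
     (THE s'. s' \<in> assignments_on \<sigma> (Dom \<sigma>) \<and>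
        (\<forall>V\<in>Dom \<sigma>. s' V =
           (case map_of xs V of
              Some x \<Rightarrow> x
            | None \<Rightarrow> if V \<in> descendants \<sigma> F (fst ` set xs) then apply_eq \<sigma> F V s' else s V)))"

definition intervene ::
  "('v, 'd) signature \<Rightarrow> ('v, 'd) cmteam \<Rightarrow> ('v, 'd) conjunction \<Rightarrow> ('v, 'd) cmteam" where
  "intervene \<sigma> T xs =
     \<lparr> rows = image_mset (intervene_row \<sigma> (eqs T) xs) (rows T),
       eqs = eqs T |` (- fst ` set xs) \<rparr>"

section \<open>The language CO\<close>

datatype ('v, 'd) co =
    CEq 'v 'd
  | CNeq 'v 'd
  | CAnd "('v, 'd) co" "('v, 'd) co"
  | COr "('v, 'd) co" "('v, 'd) co"
  | CImp "('v, 'd) co" "('v, 'd) co"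
  | CCf "('v, 'd) conjunction" "('v, 'd) co"

primrec is_co :: "('v, 'd) signature \<Rightarrow> ('v, 'd) co \<Rightarrow> bool" where
  "is_co \<sigma> (CEq Y y) \<longleftrightarrow> Y \<in> Dom \<sigma> \<and> y \<in> Ran \<sigma> Y"
| "is_co \<sigma> (CNeq Y y) \<longleftrightarrow> Y \<in> Dom \<sigma> \<and> y \<in> Ran \<sigma> Y"
| "is_co \<sigma> (CAnd \<alpha> \<beta>) \<longleftrightarrow> is_co \<sigma> \<alpha> \<and> is_co \<sigma> \<beta>"
| "is_co \<sigma> (COr \<alpha> \<beta>) \<longleftrightarrow> is_co \<sigma> \<alpha> \<and> is_co \<sigma> \<beta>"
| "is_co \<sigma> (CImp \<alpha> \<beta>) \<longleftrightarrow> is_co \<sigma> \<alpha> \<and> is_co \<sigma> \<beta>"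
| "is_co \<sigma> (CCf xs \<alpha>) \<longleftrightarrow> is_conjunction \<sigma> xs \<and> is_co \<sigma> \<alpha>"

text \<open>
  The disjunction of CO is the team-semantic one: the multiset of rows splits into two parts,
  each satisfying one disjunct.  On single rows this is the classical disjunction.
\<close>

primrec co_sat :: "('v, 'd) signature \<Rightarrow> ('v, 'd) cmteam \<Rightarrow> ('v, 'd) co \<Rightarrow> bool" where
  "co_sat \<sigma> T (CEq Y y) \<longleftrightarrow> (\<forall>s\<in>#rows T. s Y = y)"
| "co_sat \<sigma> T (CNeq Y y) \<longleftrightarrow> (\<forall>s\<in>#rows T. s Y \<noteq> y)"
| "co_sat \<sigma> T (CAnd \<alpha> \<beta>) \<longleftrightarrow> co_sat \<sigma> T \<alpha> \<and> co_sat \<sigma> T \<beta>"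
| "co_sat \<sigma> T (COr \<alpha> \<beta>) \<longleftrightarrow>
     (\<exists>A B. rows T = A + B \<and> co_sat \<sigma> (T\<lparr>rows := A\<rparr>) \<alpha> \<and> co_sat \<sigma> (T\<lparr>rows := B\<rparr>) \<beta>)"
| "co_sat \<sigma> T (CImp \<alpha> \<beta>) \<longleftrightarrow>
     co_sat \<sigma> (T\<lparr>rows := filter_mset (\<lambda>s. co_sat \<sigma> (T\<lparr>rows := {#s#}\<rparr>) \<alpha>) (rows T)\<rparr>) \<beta>"
| "co_sat \<sigma> T (CCf xs \<alpha>) \<longleftrightarrow> (consistent xs \<longrightarrow> co_sat \<sigma> (intervene \<sigma> T xs) \<alpha>)"

definition subteam :: "('v, 'd) signature \<Rightarrow> ('v, 'd) cmteam \<Rightarrow> ('v, 'd) co \<Rightarrow> ('v, 'd) cmteam" where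
  "subteam \<sigma> T \<alpha> = T\<lparr>rows := filter_mset (\<lambda>s. co_sat \<sigma> (T\<lparr>rows := {#s#}\<rparr>) \<alpha>) (rows T)\<rparr>"

section \<open>The language PCO\<close>

datatype comparison = Geq | Gt

datatype ('v, 'd) bound = Const rat | Pr "('v, 'd) co"

text \<open>
  \<open>PAtom \<alpha> r t\<close> is the probabilistic atom comparing the probability of \<open>\<alpha>\<close> by \<open>r\<close> with \<open>t\<close>.
\<close>

datatype ('v, 'd) pco =
    Eq 'v 'd
  | Neq 'v 'd
  | PAtom "('v, 'd) co" comparison "('v, 'd) bound"
  | And "('v, 'd) pco" "('v, 'd) pco"
  | BOr "('v, 'd) pco" "('v, 'd) pco"
  | Imp "('v, 'd) co" "('v, 'd) pco"
  | Cf "('v, 'd) conjunction" "('v, 'd) pco"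

primrec is_bound :: "('v, 'd) signature \<Rightarrow> ('v, 'd) bound \<Rightarrow> bool" where
  "is_bound \<sigma> (Const \<epsilon>) \<longleftrightarrow> 0 \<le> \<epsilon> \<and> \<epsilon> \<le> 1"
| "is_bound \<sigma> (Pr \<beta>) \<longleftrightarrow> is_co \<sigma> \<beta>"

primrec is_pco :: "('v, 'd) signature \<Rightarrow> ('v, 'd) pco \<Rightarrow> bool" where
  "is_pco \<sigma> (Eq Y y) \<longleftrightarrow> Y \<in> Dom \<sigma> \<and> y \<in> Ran \<sigma> Y"
| "is_pco \<sigma> (Neq Y y) \<longleftrightarrow> Y \<in> Dom \<sigma> \<and> y \<in> Ran \<sigma> Y"
| "is_pco \<sigma> (PAtom \<alpha> r t) \<longleftrightarrow> is_co \<sigma> \<alpha> \<and> is_bound \<sigma> t"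
| "is_pco \<sigma> (And \<phi> \<psi>) \<longleftrightarrow> is_pco \<sigma> \<phi> \<and> is_pco \<sigma> \<psi>"
| "is_pco \<sigma> (BOr \<phi> \<psi>) \<longleftrightarrow> is_pco \<sigma> \<phi> \<and> is_pco \<sigma> \<psi>"
| "is_pco \<sigma> (Imp \<alpha> \<phi>) \<longleftrightarrow> is_co \<sigma> \<alpha> \<and> is_pco \<sigma> \<phi>"
| "is_pco \<sigma> (Cf xs \<phi>) \<longleftrightarrow> is_conjunction \<sigma> xs \<and> is_pco \<sigma> \<phi>"

definition prob :: "('v, 'd) signature \<Rightarrow> ('v, 'd) cmteam \<Rightarrow> ('v, 'd) co \<Rightarrow> rat" where
  "prob \<sigma> T \<alpha> = of_nat (size (rows (subteam \<sigma> T \<alpha>))) / of_nat (size (rows T))"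

primrec compare :: "comparison \<Rightarrow> rat \<Rightarrow> rat \<Rightarrow> bool" where
  "compare Geq a b \<longleftrightarrow> a \<ge> b"
| "compare Gt a b \<longleftrightarrow> a > b"

primrec bound_value ::
  "('v, 'd) signature \<Rightarrow> ('v, 'd) cmteam \<Rightarrow> ('v, 'd) bound \<Rightarrow> rat" where
  "bound_value \<sigma> T (Const \<epsilon>) = \<epsilon>"
| "bound_value \<sigma> T (Pr \<beta>) = prob \<sigma> T \<beta>"

primrec pco_sat :: "('v, 'd) signature \<Rightarrow> ('v, 'd) cmteam \<Rightarrow> ('v, 'd) pco \<Rightarrow> bool" where
  "pco_sat \<sigma> T (Eq Y y) \<longleftrightarrow> (\<forall>s\<in>#rows T. s Y = y)"
| "pco_sat \<sigma> T (Neq Y y) \<longleftrightarrow> (\<forall>s\<in>#rows T. s Y \<noteq> y)"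
| "pco_sat \<sigma> T (PAtom \<alpha> r t) \<longleftrightarrow>
     rows T = {#} \<or> compare r (prob \<sigma> T \<alpha>) (bound_value \<sigma> T t)"
| "pco_sat \<sigma> T (And \<phi> \<psi>) \<longleftrightarrow> pco_sat \<sigma> T \<phi> \<and> pco_sat \<sigma> T \<psi>"
| "pco_sat \<sigma> T (BOr \<phi> \<psi>) \<longleftrightarrow> pco_sat \<sigma> T \<phi> \<or> pco_sat \<sigma> T \<psi>"
| "pco_sat \<sigma> T (Imp \<alpha> \<phi>) \<longleftrightarrow> pco_sat \<sigma> (subteam \<sigma> T \<alpha>) \<phi>"
| "pco_sat \<sigma> T (Cf xs \<phi>) \<longleftrightarrow> (consistent xs \<longrightarrow> pco_sat \<sigma> (intervene \<sigma> T xs) \<phi>)"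

definition pco_equiv :: "('v, 'd) signature \<Rightarrow> ('v, 'd) pco \<Rightarrow> ('v, 'd) pco \<Rightarrow> bool" where
  "pco_equiv \<sigma> \<phi> \<psi> \<longleftrightarrow>
     (\<forall>T. is_causal_multiteam \<sigma> T \<longrightarrow> pco_sat \<sigma> T \<phi> = pco_sat \<sigma> T \<psi>)"

section \<open>Normal forms\<close>

text \<open>
  Subformulas are those generated by the PCO grammar itself; the CO formulas occurring inside
  probabilistic atoms and as antecedents of \<open>Imp\<close> are not decomposed.
\<close>

primrec subformulas :: "('v, 'd) pco \<Rightarrow> ('v, 'd) pco set" where
  "subformulas (Eq Y y) = {Eq Y y}"
| "subformulas (Neq Y y) = {Neq Y y}"
| "subformulas (PAtom \<alpha> r t) = {PAtom \<alpha> r t}"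
| "subformulas (And \<phi> \<psi>) = insert (And \<phi> \<psi>) (subformulas \<phi> \<union> subformulas \<psi>)"
| "subformulas (BOr \<phi> \<psi>) = insert (BOr \<phi> \<psi>) (subformulas \<phi> \<union> subformulas \<psi>)"
| "subformulas (Imp \<alpha> \<phi>) = insert (Imp \<alpha> \<phi>) (subformulas \<phi>)"
| "subformulas (Cf xs \<phi>) = insert (Cf xs \<phi>) (subformulas \<phi>)"

definition is_prob_atom :: "('v, 'd) pco \<Rightarrow> bool" where
  "is_prob_atom \<phi> \<longleftrightarrow> (\<exists>\<alpha> r t. \<phi> = PAtom \<alpha> r t)"

definition is_counterfactual :: "('v, 'd) pco \<Rightarrow> bool" where
  "is_counterfactual \<phi> \<longleftrightarrow> (\<exists>xs \<psi>. \<phi> = Cf xs \<psi>)"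

definition cf_consequents_prob_atoms :: "('v, 'd) pco \<Rightarrow> bool" where
  "cf_consequents_prob_atoms \<phi> \<longleftrightarrow>
     (\<forall>xs \<psi>. Cf xs \<psi> \<in> subformulas \<phi> \<longrightarrow> is_prob_atom \<psi>)"

definition imp_consequents_cf_or_prob_atoms :: "('v, 'd) pco \<Rightarrow> bool" where
  "imp_consequents_cf_or_prob_atoms \<phi> \<longleftrightarrow>
     (\<forall>\<alpha> \<psi>. Imp \<alpha> \<psi> \<in> subformulas \<phi> \<longrightarrow> is_counterfactual \<psi> \<or> is_prob_atom \<psi>)"

definition is_basic_form :: "('v, 'd) pco \<Rightarrow> bool" where
  "is_basic_form \<phi> \<longleftrightarrow>
     (\<exists>\<gamma> \<alpha> r t. \<phi> = Imp \<gamma> (PAtom \<alpha> r t)) \<or>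
     (\<exists>xs \<alpha> r t. \<phi> = Cf xs (PAtom \<alpha> r t)) \<or>
     (\<exists>\<gamma> xs \<alpha> r t. \<phi> = Imp \<gamma> (Cf xs (PAtom \<alpha> r t)))"

inductive boolean_combination :: "(('v, 'd) pco \<Rightarrow> bool) \<Rightarrow> ('v, 'd) pco \<Rightarrow> bool"
  for P :: "('v, 'd) pco \<Rightarrow> bool" where
  base: "P \<phi> \<Longrightarrow> boolean_combination P \<phi>"
| conj: "boolean_combination P \<phi> \<Longrightarrow> boolean_combination P \<psi> \<Longrightarrow>
         boolean_combination P (And \<phi> \<psi>)"
| disj: "boolean_combination P \<phi> \<Longrightarrow> boolean_combination P \<psi> \<Longrightarrow>
         boolean_combination P (BOr \<phi> \<psi>)"

end

(* A literal says that an event has probability 1, and an atom is its own consequence under a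
   tautological antecedent; the rest is pushing antecedents inwards.  Both kinds of conditional
   distribute over conjunction and Boolean disjunction, nested implications merge into one with a
   conjunctive antecedent, a counterfactual commutes with a selective implication after turning the
   antecedent into a counterfactual, and nested counterfactuals merge into one in which the inner
   intervention overrides the outer.  The last step rests on describing the updated row as the
   unique solution of all equations not intervened upon; descendants then no longer matter. *)

theory Submission
  imports Defs
begin

section \<open>Solving the equations after an intervention\<close>

lemma assignments_onD: "s \<in> assignments_on \<sigma> W \<Longrightarrow> V \<in> W \<Longrightarrow> s V \<in> Ran \<sigma> V"
  by (auto simp: assignments_on_def)

lemma restrict_assignments_on:
  "(\<And>V. V \<in> W \<Longrightarrow> s V \<in> Ran \<sigma> V) \<Longrightarrow> restrict s W \<in> assignments_on \<sigma> W"
  by (auto simp: assignments_on_def)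

lemma finite_causal_graph:
  assumes "is_signature \<sigma>" "is_function_component \<sigma> F"
  shows "finite (causal_graph \<sigma> F)"
proof (rule finite_subset)
  show "causal_graph \<sigma> F \<subseteq> Dom \<sigma> \<times> Dom \<sigma>"
    using assms(2) by (auto simp: causal_graph_def is_function_component_def)
  show "finite (Dom \<sigma> \<times> Dom \<sigma>)" using assms(1) by (simp add: is_signature_def)
qed

section \<open>Structural equations: range and dependence on parents\<close>

lemma apply_eq_in_Ran:
  assumes "is_function_component \<sigma> F" "V \<in> dom F" "\<And>U. U \<in> Dom \<sigma> \<Longrightarrow> w U \<in> Ran \<sigma> U"
  shows "apply_eq \<sigma> F V w \<in> Ran \<sigma> V"
proof -
  obtain f where f: "F V = Some f" using assms(2) by auto
  moreover have "f \<in> assignments_on \<sigma> (Dom \<sigma> - {V}) \<rightarrow>\<^sub>E Ran \<sigma> V"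
    using assms(1) f by (auto simp: is_function_component_def)
  moreover have "restrict w (Dom \<sigma> - {V}) \<in> assignments_on \<sigma> (Dom \<sigma> - {V})"
    using assms(3) by (intro restrict_assignments_on) auto
  ultimately show ?thesis by (auto simp: apply_eq_def)
qed

text \<open>An edge of the causal graph records dependence under a change of one argument, while
  here \<open>w\<close> and \<open>w'\<close> may differ at all non-parents simultaneously. As
  \<open>Dom \<sigma>\<close> is finite, a chain of single changes, each along a non-edge, leads
  from one to the other.\<close>

lemma apply_eq_cong_parents:
  assumes "is_signature \<sigma>" "V \<in> dom F"
    and w: "\<And>U. U \<in> Dom \<sigma> \<Longrightarrow> w U \<in> Ran \<sigma> U" and w': "\<And>U. U \<in> Dom \<sigma> \<Longrightarrow> w' U \<in> Ran \<sigma> U"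
    and eq: "\<And>U. (U, V) \<in> causal_graph \<sigma> F \<Longrightarrow> w U = w' U"
  shows "apply_eq \<sigma> F V w = apply_eq \<sigma> F V w'"
proof -
  obtain f where f: "F V = Some f" using assms(2) by auto
  define W where "W = Dom \<sigma> - {V}"
  \<comment> \<open>Interpolates between \<open>w\<close> (empty \<open>A\<close>) and
    \<open>w'\<close> (\<open>A\<close> all non-parents in \<open>W\<close>, since the two rows
    agree on the parents).\<close>
  define mix where "mix A = restrict (\<lambda>Z. if Z \<in> A then w' Z else w Z) W" for A
  have mix: "mix A \<in> assignments_on \<sigma> W" for A
    unfolding mix_def using w w' by (intro restrict_assignments_on) (auto simp: W_def)
  have no_edge: "f v = f v'"
    if "X \<in> W" "(X, V) \<notin> causal_graph \<sigma> F" "v \<in> assignments_on \<sigma> W" "v' \<in> assignments_on \<sigma> W"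
      "\<forall>Z. Z \<noteq> X \<longrightarrow> v Z = v' Z" for X v v'
  proof (rule ccontr)
    assume "f v \<noteq> f v'"
    with f that have "(X, V) \<in> causal_graph \<sigma> F"
      unfolding causal_graph_def W_def
      by (intro CollectI case_prodI conjI exI[of _ f] bexI[of _ v] bexI[of _ v']) simp_all
    with that(2) show False by contradiction
  qed
  \<comment> \<open>Replace the values of the non-parents one at a time.\<close>
  have step: "f (mix A) = f (mix {})"
    if "finite A" "A \<subseteq> {Z \<in> W. (Z, V) \<notin> causal_graph \<sigma> F}" for A
    using that
  proof (induction A rule: finite_induct)
    case empty
    then show ?case by simp
  next
    case (insert X A)
    have "\<forall>Z. Z \<noteq> X \<longrightarrow> mix (insert X A) Z = mix A Z"
      by (simp add: mix_def restrict_def)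
    moreover have "X \<in> W" "(X, V) \<notin> causal_graph \<sigma> F"
      using insert.prems by simp_all
    ultimately have "f (mix (insert X A)) = f (mix A)"
      using no_edge[OF _ _ mix mix] by simp
    with insert.IH insert.prems show ?case by simp
  qed
  define A where "A = {Z \<in> W. (Z, V) \<notin> causal_graph \<sigma> F}"
  have "finite A" using assms(1) by (simp add: A_def W_def is_signature_def)
  then have "f (mix A) = f (mix {})" by (rule step) (simp add: A_def)
  moreover have "mix A = restrict w' W"
  proof
    fix Z
    show "mix A Z = restrict w' W Z"
      by (cases "(Z, V) \<in> causal_graph \<sigma> F") (simp_all add: mix_def A_def eq)
  qed
  moreover have "mix {} = restrict w W" by (simp add: mix_def)
  ultimately show ?thesis using f by (simp add: apply_eq_def W_def)
qed

text \<open>Every endogenous variable not intervened upon is recomputed from the candidate row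
  \<open>w\<close>, whether or not it is a descendant. The old row \<open>s\<close> only supplies
  exogenous values, so two successive interventions can be compared variable by variable.\<close>

definition updated_value ::
  "('v, 'd) signature \<Rightarrow> ('v, 'd) equations \<Rightarrow> ('v, 'd) conjunction \<Rightarrow> ('v, 'd) assignment \<Rightarrow>
   ('v, 'd) assignment \<Rightarrow> 'v \<Rightarrow> 'd" where
  "updated_value \<sigma> F xs s w V =
     (case map_of xs V of
        Some x \<Rightarrow> x
      | None \<Rightarrow> if V \<in> dom F then apply_eq \<sigma> F V w else s V)"

definition solves ::
  "('v, 'd) signature \<Rightarrow> ('v, 'd) equations \<Rightarrow> ('v, 'd) conjunction \<Rightarrow> ('v, 'd) assignment \<Rightarrow>
   ('v, 'd) assignment \<Rightarrow> bool" where
  "solves \<sigma> F xs s s' \<longleftrightarrow>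
     s' \<in> assignments_on \<sigma> (Dom \<sigma>) \<and> (\<forall>V\<in>Dom \<sigma>. s' V = updated_value \<sigma> F xs s s' V)"

lemma updated_value_in_Ran:
  assumes "is_function_component \<sigma> F" "is_conjunction \<sigma> xs" "s \<in> assignments_on \<sigma> (Dom \<sigma>)"
    and "V \<in> Dom \<sigma>" "\<And>U. U \<in> Dom \<sigma> \<Longrightarrow> w U \<in> Ran \<sigma> U"
  shows "updated_value \<sigma> F xs s w V \<in> Ran \<sigma> V"
proof (cases "map_of xs V")
  case None
  then show ?thesis
    using apply_eq_in_Ran[OF assms(1) _ assms(5), of V] assignments_onD[OF assms(3,4)]
    by (simp add: updated_value_def)
next
  case (Some x)
  then have "(V, x) \<in> set xs" by (rule map_of_SomeD)
  with assms(2) Some show ?thesis by (auto simp: updated_value_def is_conjunction_def)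
qed

lemma updated_value_cong_parents:
  assumes "is_signature \<sigma>"
    and "\<And>U. U \<in> Dom \<sigma> \<Longrightarrow> w U \<in> Ran \<sigma> U" "\<And>U. U \<in> Dom \<sigma> \<Longrightarrow> w' U \<in> Ran \<sigma> U"
    and "\<And>U. (U, V) \<in> causal_graph \<sigma> F \<Longrightarrow> w U = w' U"
  shows "updated_value \<sigma> F xs s w V = updated_value \<sigma> F xs s w' V"
proof (cases "V \<in> dom F")
  case True
  then have "apply_eq \<sigma> F V w = apply_eq \<sigma> F V w'"
    using assms by (intro apply_eq_cong_parents)
  then show ?thesis by (simp add: updated_value_def split: option.split)
qed (simp add: updated_value_def split: option.split)

lemma causal_graph_DomD: "(U, V) \<in> causal_graph \<sigma> F \<Longrightarrow> U \<in> Dom \<sigma>"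
  by (auto simp: causal_graph_def)

text \<open>A finite acyclic causal graph is well-founded, and the value at a variable depends only
  on its parents: well-founded recursion gives a solution, well-founded induction its
  uniqueness.\<close>

lemma ex1_solves:
  assumes sig: "is_signature \<sigma>" and F: "is_function_component \<sigma> F"
    and acyc: "acyclic (causal_graph \<sigma> F)" and xs: "is_conjunction \<sigma> xs"
    and s: "s \<in> assignments_on \<sigma> (Dom \<sigma>)"
  shows "\<exists>!s'. solves \<sigma> F xs s s'"
proof (rule ex_ex1I)
  let ?r = "causal_graph \<sigma> F"
  let ?G = "updated_value \<sigma> F xs s"
  have wf: "wf ?r"
    using finite_causal_graph[OF sig F] acyc by (rule finite_acyclic_wf)
  \<comment> \<open>The recursion may read \<open>f\<close> only at parents of \<open>V\<close>.
    Filling the other places from \<open>s\<close> keeps all values within their ranges, and by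
    dependence on parents alone the filler does not affect the result.\<close>
  define patch where "patch f V = (\<lambda>U. if (U, V) \<in> ?r then f U else s U)" for f V
  define h where "h = wfrec ?r (\<lambda>f V. ?G (patch f V) V)"
  have h: "h V = ?G (patch h V) V" for V
  proof -
    have "patch (cut h ?r V) V = patch h V"
      by (auto simp: patch_def cut_def fun_eq_iff)
    with wfrec[OF wf, of "\<lambda>f V. ?G (patch f V) V" V] show ?thesis
      by (simp flip: h_def)
  qed
  have h_Ran: "V \<in> Dom \<sigma> \<longrightarrow> h V \<in> Ran \<sigma> V" for V
    using wf
  proof (induction V rule: wf_induct_rule)
    case (less V)
    have "V \<in> Dom \<sigma> \<Longrightarrow> ?G (patch h V) V \<in> Ran \<sigma> V"
      using less assignments_onD[OF s] by (intro updated_value_in_Ran[OF F xs s]) (auto simp: patch_def)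
    then show ?case by (subst h) blast
  qed
  \<comment> \<open>Assignments are extensional functions, so the recursive solution is cut down to
    \<open>Dom \<sigma>\<close>.\<close>
  have "restrict h (Dom \<sigma>) \<in> assignments_on \<sigma> (Dom \<sigma>)"
    using h_Ran by (intro restrict_assignments_on) auto
  moreover have "?G (patch h V) V = ?G (restrict h (Dom \<sigma>)) V" for V
    using h_Ran assignments_onD[OF s]
    by (intro updated_value_cong_parents[OF sig]) (auto simp: patch_def causal_graph_DomD)
  ultimately show "\<exists>s'. solves \<sigma> F xs s s'"
    using h by (intro exI[of _ "restrict h (Dom \<sigma>)"]) (simp add: solves_def)
next
  fix t t'
  let ?r = "causal_graph \<sigma> F"
  assume t: "solves \<sigma> F xs s t" and t': "solves \<sigma> F xs s t'"
  have wf: "wf ?r"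
    using finite_causal_graph[OF sig F] acyc by (rule finite_acyclic_wf)
  have assignment: "t \<in> assignments_on \<sigma> (Dom \<sigma>)" "t' \<in> assignments_on \<sigma> (Dom \<sigma>)"
    using t t' by (simp_all add: solves_def)
  have "V \<in> Dom \<sigma> \<longrightarrow> t V = t' V" for V
    using wf
  proof (induction V rule: wf_induct_rule)
    case (less V)
    have "t U = t' U" if "(U, V) \<in> causal_graph \<sigma> F" for U
      using less[OF that] causal_graph_DomD[OF that] by simp
    then have "updated_value \<sigma> F xs s t V = updated_value \<sigma> F xs s t' V"
      using assignments_onD[OF assignment(1)] assignments_onD[OF assignment(2)]
      by (intro updated_value_cong_parents[OF sig])
    with t t' show ?case by (simp add: solves_def)
  qed
  with t t' show "t = t'"
    by (auto simp: solves_def assignments_on_def intro: PiE_ext)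
qed

section \<open>Agreement with the updated row defined through descendants\<close>

lemma descendants_step:
  assumes "(U, V) \<in> causal_graph \<sigma> F" "U \<in> A \<or> U \<in> descendants \<sigma> F A"
  shows "V \<in> descendants \<sigma> F A"
  using assms by (auto simp: descendants_def intro: trancl_into_trancl)

lemma descendants_subset_dom: "descendants \<sigma> F A \<subseteq> dom F"
proof
  fix V
  assume "V \<in> descendants \<sigma> F A"
  then obtain U where "(U, V) \<in> causal_graph \<sigma> F"
    by (auto simp: descendants_def elim: tranclE)
  then show "V \<in> dom F" by (auto simp: causal_graph_def)
qed

text \<open>Compatibility of \<open>s\<close> with \<open>F\<close> makes the recomputation of
  unaffected variables harmless: if their parents keep their old values, the equation returns the
  old value again.\<close>

lemma solves_iff_descendants:
  assumes sig: "is_signature \<sigma>" and F: "is_function_component \<sigma> F"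
    and acyc: "acyclic (causal_graph \<sigma> F)"
    and s: "s \<in> assignments_on \<sigma> (Dom \<sigma>)"
    and comp: "\<forall>Y\<in>dom F. s Y = apply_eq \<sigma> F Y s"
  shows "s' \<in> assignments_on \<sigma> (Dom \<sigma>) \<and>
        (\<forall>V\<in>Dom \<sigma>. s' V =
           (case map_of xs V of
              Some x \<Rightarrow> x
            | None \<Rightarrow> if V \<in> descendants \<sigma> F (fst ` set xs) then apply_eq \<sigma> F V s' else s V))
     \<longleftrightarrow> solves \<sigma> F xs s s'"
    (is "?A \<and> ?B \<longleftrightarrow> _")
proof (cases ?A)
  case False
  then show ?thesis by (simp add: solves_def)
next
  case A: True
  let ?D = "descendants \<sigma> F (fst ` set xs)"
  \<comment> \<open>The unaffected variables; this set is closed under parents.\<close>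
  let ?N = "{V \<in> Dom \<sigma>. V \<notin> fst ` set xs \<and> V \<notin> ?D}"
  have parent_N: "U \<in> ?N" if "(U, V) \<in> causal_graph \<sigma> F" "V \<in> ?N" for U V
    using that descendants_step[of U V \<sigma> F "fst ` set xs"] by (auto simp: causal_graph_DomD)
  have same: "apply_eq \<sigma> F V s' = s V"
    if "V \<in> dom F" "\<And>U. (U, V) \<in> causal_graph \<sigma> F \<Longrightarrow> s' U = s U" for V
    using apply_eq_cong_parents[OF sig that(1) assignments_onD[OF A] assignments_onD[OF s] that(2)]
      comp that(1) by simp
  have None: "map_of xs V = None" if "V \<in> ?N" for V
    using that by (simp add: map_of_eq_None_iff)
  \<comment> \<open>Given agreement with \<open>s\<close> on \<open>?N\<close>, the two systems
    coincide line by line: on \<open>?N\<close> both give \<open>s V\<close>, and elsewhere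
    \<open>V\<close> is either set by \<open>xs\<close> or a descendant, hence endogenous.\<close>
  have *: "?B \<longleftrightarrow> (\<forall>V\<in>Dom \<sigma>. s' V = updated_value \<sigma> F xs s s' V)" if sN: "\<forall>V\<in>?N. s' V = s V"
  proof -
    have "(case map_of xs V of Some x \<Rightarrow> x
            | None \<Rightarrow> if V \<in> ?D then apply_eq \<sigma> F V s' else s V) = updated_value \<sigma> F xs s s' V"
      if V: "V \<in> Dom \<sigma>" for V
    proof (cases "V \<in> ?N")
      case True
      then have "apply_eq \<sigma> F V s' = s V" if "V \<in> dom F"
        using same[OF that] parent_N sN by blast
      with True None[OF True] show ?thesis by (simp add: updated_value_def)
    next
      case False
      with V descendants_subset_dom[of \<sigma> F "fst ` set xs"] show ?thesis
        by (auto simp: updated_value_def map_of_eq_None_iff split: option.split)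
    qed
    then show ?thesis by simp
  qed
  have 1: "\<forall>V\<in>?N. s' V = s V" if ?B
  proof
    fix V
    assume V: "V \<in> ?N"
    with that None[OF V] show "s' V = s V" by simp
  qed
  \<comment> \<open>The full system does not state this agreement directly; it follows by induction
    along the causal graph, never leaving \<open>?N\<close>.\<close>
  have 2: "\<forall>V\<in>?N. s' V = s V" if sol: "\<forall>V\<in>Dom \<sigma>. s' V = updated_value \<sigma> F xs s s' V"
  proof -
    have "V \<in> ?N \<longrightarrow> s' V = s V" for V
      using finite_acyclic_wf[OF finite_causal_graph[OF sig F] acyc]
    proof (induction V rule: wf_induct_rule)
      case (less V)
      show ?case
      proof
        assume V: "V \<in> ?N"
        then have "apply_eq \<sigma> F V s' = s V" if "V \<in> dom F"
          using same[OF that] less parent_N by blast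
        with V None[OF V] sol show "s' V = s V" by (simp add: updated_value_def)
      qed
    qed
    then show ?thesis by blast
  qed
  have "?B \<longleftrightarrow> (\<forall>V\<in>Dom \<sigma>. s' V = updated_value \<sigma> F xs s s' V)" (is "_ \<longleftrightarrow> ?sol")
  proof
    assume ?B
    from *[OF 1[OF this]] this show ?sol by (rule iffD1)
  next
    assume ?sol
    from *[OF 2[OF this]] this show ?B by (rule iffD2)
  qed
  then show ?thesis unfolding solves_def by (rule conj_cong[OF refl])
qed

text \<open>Trades the definite description for a unique solution, the form in which updated rows
  are handled from here on.\<close>

lemma solves_iff_intervene_row:
  assumes "is_signature \<sigma>" "is_causal_multiteam \<sigma> T" "s \<in># rows T" "is_conjunction \<sigma> xs"
  shows "solves \<sigma> (eqs T) xs s s' \<longleftrightarrow> s' = intervene_row \<sigma> (eqs T) xs s"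
proof -
  have F: "is_function_component \<sigma> (eqs T)" "acyclic (causal_graph \<sigma> (eqs T))"
    and s: "s \<in> assignments_on \<sigma> (Dom \<sigma>)" "\<forall>Y\<in>dom (eqs T). s Y = apply_eq \<sigma> (eqs T) Y s"
    using assms(2,3) by (auto simp: is_causal_multiteam_def)
  have row: "intervene_row \<sigma> (eqs T) xs s = (THE s'. solves \<sigma> (eqs T) xs s s')"
    unfolding intervene_row_def solves_iff_descendants[OF assms(1) F s] by (rule refl)
  note ex1 = ex1_solves[OF assms(1) F assms(4) s(1)]
  show ?thesis
    unfolding row using theI'[OF ex1] the1_equality[OF ex1, of s'] by auto
qed

lemma apply_eq_restrict_map: "V \<in> A \<Longrightarrow> apply_eq \<sigma> (F |` A) V = apply_eq \<sigma> F V"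
  by (simp add: apply_eq_def fun_eq_iff)

text \<open>Equivalence quantifies over causal multiteams only, so this closure is what allows
  rewriting below a counterfactual and intervening twice. Deleting equations only removes edges, and
  the surviving ones hold because the new row solves them.\<close>

lemma is_causal_multiteam_intervene:
  assumes "is_signature \<sigma>" "is_causal_multiteam \<sigma> T" "is_conjunction \<sigma> xs"
  shows "is_causal_multiteam \<sigma> (intervene \<sigma> T xs)"
proof -
  let ?F = "eqs T |` (- fst ` set xs)"
  have F: "is_function_component \<sigma> (eqs T)" "acyclic (causal_graph \<sigma> (eqs T))"
    using assms(2) by (auto simp: is_causal_multiteam_def)
  have sub: "?F V = Some f \<Longrightarrow> eqs T V = Some f" for V f
    by (auto simp: restrict_map_def split: if_splits)
  have "is_function_component \<sigma> ?F"
    unfolding is_function_component_def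
  proof (intro conjI allI impI)
    show "dom ?F \<subseteq> Dom \<sigma>" using F(1) by (auto simp: is_function_component_def)
  qed (use F(1) in \<open>simp_all add: is_function_component_def sub\<close>)
  moreover have "causal_graph \<sigma> ?F \<subseteq> causal_graph \<sigma> (eqs T)"
    unfolding causal_graph_def by (force dest: sub)
  with F(2) have "acyclic (causal_graph \<sigma> ?F)" by (rule acyclic_subset)
  moreover have "s' \<in> assignments_on \<sigma> (Dom \<sigma>) \<and> (\<forall>Y\<in>dom ?F. s' Y = apply_eq \<sigma> ?F Y s')"
    if "s \<in># rows T" and s': "s' = intervene_row \<sigma> (eqs T) xs s" for s s'
  proof -
    have sol: "solves \<sigma> (eqs T) xs s s'"
      using solves_iff_intervene_row[OF assms(1,2) that(1) assms(3)] s' by simp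
    have "s' Y = apply_eq \<sigma> ?F Y s'" if Y: "Y \<in> dom ?F" for Y
    proof -
      from Y have "Y \<in> dom (eqs T)" "Y \<in> - fst ` set xs" by auto
      moreover have "Y \<in> Dom \<sigma>"
        using F(1) \<open>Y \<in> dom (eqs T)\<close> by (auto simp: is_function_component_def)
      moreover have "map_of xs Y = None"
        using \<open>Y \<in> - fst ` set xs\<close> by (simp add: map_of_eq_None_iff)
      ultimately show ?thesis
        using sol by (simp add: solves_def updated_value_def apply_eq_restrict_map)
    qed
    with sol show ?thesis by (auto simp: solves_def)
  qed
  ultimately show ?thesis
    by (auto simp: is_causal_multiteam_def intervene_def)
qed

section \<open>Merging nested interventions\<close>

text \<open>Lookup would prefer \<open>ys\<close> by its position alone; filtering \<open>xs\<close>
  also keeps the merged conjunction consistent when the two assign different values to a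
  variable.\<close>

definition override_conjunction ::
  "('v, 'd) conjunction \<Rightarrow> ('v, 'd) conjunction \<Rightarrow> ('v, 'd) conjunction" where
  "override_conjunction xs ys = ys @ filter (\<lambda>(X, x). X \<notin> fst ` set ys) xs"

lemma map_of_override_conjunction:
  "map_of (override_conjunction xs ys) V = (case map_of ys V of None \<Rightarrow> map_of xs V | Some y \<Rightarrow> Some y)"
proof (cases "map_of ys V")
  case None
  then have "V \<notin> fst ` set ys" by (simp add: map_of_eq_None_iff)
  then have "map_of (filter (\<lambda>(X, x). X \<notin> fst ` set ys) xs) V = map_of xs V"
    by (induction xs) (auto simp: case_prod_beta)
  with None show ?thesis by (simp add: override_conjunction_def map_add_def)
next
  case (Some y)
  then show ?thesis by (simp add: override_conjunction_def)
qed

lemma fst_set_override_conjunction: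
  "fst ` set (override_conjunction xs ys) = fst ` set xs \<union> fst ` set ys"
  unfolding dom_map_of_conv_image_fst[symmetric]
  by (auto simp: map_of_override_conjunction split: option.splits)

lemma is_conjunction_override:
  "is_conjunction \<sigma> xs \<Longrightarrow> is_conjunction \<sigma> ys \<Longrightarrow> is_conjunction \<sigma> (override_conjunction xs ys)"
  by (auto simp: is_conjunction_def override_conjunction_def)

lemma consistent_override:
  assumes "consistent xs" "consistent ys"
  shows "consistent (override_conjunction xs ys)"
  unfolding consistent_def
proof (intro allI impI)
  fix X x x'
  assume "(X, x) \<in> set (override_conjunction xs ys)" "(X, x') \<in> set (override_conjunction xs ys)"
  then have "(X, x) \<in> set ys \<and> (X, x') \<in> set ys \<or> (X, x) \<in> set xs \<and> (X, x') \<in> set xs"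
    by (force simp: override_conjunction_def)
  with assms show "x = x'" unfolding consistent_def by blast
qed

text \<open>The doubly updated row solves the system of the merged intervention on the original row,
  so uniqueness of solutions identifies the two.\<close>

lemma intervene_intervene:
  assumes "is_signature \<sigma>" "is_causal_multiteam \<sigma> T" "is_conjunction \<sigma> xs" "is_conjunction \<sigma> ys"
  shows "intervene \<sigma> (intervene \<sigma> T xs) ys = intervene \<sigma> T (override_conjunction xs ys)"
proof -
  let ?F = "eqs T" and ?F' = "eqs T |` (- fst ` set xs)"
  have eqs: "eqs (intervene \<sigma> T xs) = ?F'" by (simp add: intervene_def)
  have "intervene_row \<sigma> ?F' ys (intervene_row \<sigma> ?F xs s) =
        intervene_row \<sigma> ?F (override_conjunction xs ys) s" if s: "s \<in># rows T" for s
  proof -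
    define s1 where "s1 = intervene_row \<sigma> ?F xs s"
    define s2 where "s2 = intervene_row \<sigma> ?F' ys s1"
    have sol1: "solves \<sigma> ?F xs s s1"
      using solves_iff_intervene_row[OF assms(1,2) s assms(3)] s1_def by simp
    have "s1 \<in># rows (intervene \<sigma> T xs)" using s by (simp add: intervene_def s1_def)
    from solves_iff_intervene_row[OF assms(1) is_causal_multiteam_intervene[OF assms(1-3)] this assms(4)]
    have sol2: "solves \<sigma> ?F' ys s1 s2" by (simp add: eqs s2_def)
    have "s2 V = updated_value \<sigma> ?F (override_conjunction xs ys) s s2 V" if V: "V \<in> Dom \<sigma>" for V
    proof -
      have v1: "s1 V = updated_value \<sigma> ?F xs s s1 V" and v2: "s2 V = updated_value \<sigma> ?F' ys s1 s2 V"
        using sol1 sol2 V by (auto simp: solves_def)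
      show ?thesis
      \<comment> \<open>If \<open>xs\<close> sets \<open>V\<close>, its equation is gone and the
        second intervention treats \<open>V\<close> as exogenous, keeping the value from
        \<open>xs\<close> unless \<open>ys\<close> overrides it. Otherwise both systems have the
        same equation for \<open>V\<close>, or none.\<close>
      proof (cases "V \<in> fst ` set xs")
        case True
        then have "V \<notin> dom ?F'" by auto
        moreover obtain x where "map_of xs V = Some x"
          using True by (cases "map_of xs V") (auto simp: map_of_eq_None_iff)
        ultimately show ?thesis
          using v1 v2
          by (cases "map_of ys V") (auto simp: updated_value_def map_of_override_conjunction)
      next
        case False
        then have "map_of xs V = None" "V \<in> dom ?F' \<longleftrightarrow> V \<in> dom ?F"
          "apply_eq \<sigma> ?F' V = apply_eq \<sigma> ?F V"
          by (auto simp: map_of_eq_None_iff apply_eq_restrict_map)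
        then show ?thesis
          using v1 v2
          by (cases "map_of ys V")
            (simp_all add: updated_value_def map_of_override_conjunction split: if_splits)
      qed
    qed
    with sol2 have "solves \<sigma> ?F (override_conjunction xs ys) s s2" by (auto simp: solves_def)
    then show ?thesis
      using solves_iff_intervene_row[OF assms(1,2) s is_conjunction_override[OF assms(3,4)]]
      by (simp add: s1_def s2_def)
  qed
  then have "image_mset (intervene_row \<sigma> ?F' ys) (image_mset (intervene_row \<sigma> ?F xs) (rows T)) =
      image_mset (intervene_row \<sigma> ?F (override_conjunction xs ys)) (rows T)"
    unfolding multiset.map_comp by (intro image_mset_cong) simp
  moreover have "?F' |` (- fst ` set ys) = ?F |` (- fst ` set (override_conjunction xs ys))"
    by (auto simp: fst_set_override_conjunction restrict_map_def fun_eq_iff)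
  ultimately show ?thesis by (simp add: intervene_def)
qed

section \<open>Equivalences that push antecedents inwards\<close>

lemma is_causal_multiteam_subteam:
  "is_causal_multiteam \<sigma> T \<Longrightarrow> is_causal_multiteam \<sigma> (subteam \<sigma> T \<alpha>)"
  by (auto simp: is_causal_multiteam_def subteam_def)

lemma co_sat_empty: "rows T = {#} \<Longrightarrow> co_sat \<sigma> T \<alpha>"
  by (induction \<alpha> arbitrary: T) (auto simp: intervene_def)

section \<open>Congruence and commutation laws\<close>

lemma pco_equiv_trans [trans]: "pco_equiv \<sigma> \<phi> \<psi> \<Longrightarrow> pco_equiv \<sigma> \<psi> \<chi> \<Longrightarrow> pco_equiv \<sigma> \<phi> \<chi>"
  by (simp add: pco_equiv_def)

lemma pco_equiv_And_cong:
  "pco_equiv \<sigma> \<phi> \<phi>' \<Longrightarrow> pco_equiv \<sigma> \<psi> \<psi>' \<Longrightarrow> pco_equiv \<sigma> (And \<phi> \<psi>) (And \<phi>' \<psi>')"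
  by (simp add: pco_equiv_def)

lemma pco_equiv_BOr_cong:
  "pco_equiv \<sigma> \<phi> \<phi>' \<Longrightarrow> pco_equiv \<sigma> \<psi> \<psi>' \<Longrightarrow> pco_equiv \<sigma> (BOr \<phi> \<psi>) (BOr \<phi>' \<psi>')"
  by (simp add: pco_equiv_def)

lemma pco_equiv_Imp_cong: "pco_equiv \<sigma> \<phi> \<phi>' \<Longrightarrow> pco_equiv \<sigma> (Imp \<alpha> \<phi>) (Imp \<alpha> \<phi>')"
  by (simp add: pco_equiv_def is_causal_multiteam_subteam)

lemma pco_equiv_Cf_cong:
  "is_signature \<sigma> \<Longrightarrow> is_conjunction \<sigma> xs \<Longrightarrow> pco_equiv \<sigma> \<phi> \<phi>' \<Longrightarrow> pco_equiv \<sigma> (Cf xs \<phi>) (Cf xs \<phi>')"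
  by (simp add: pco_equiv_def is_causal_multiteam_intervene)

lemma subteam_subteam: "subteam \<sigma> (subteam \<sigma> T \<alpha>) \<beta> = subteam \<sigma> T (CAnd \<alpha> \<beta>)"
  by (simp add: subteam_def filter_filter_mset conj_commute)

text \<open>Rows are updated independently, so an updated row satisfies \<open>\<gamma>\<close>
  exactly when the original row satisfies the counterfactual.\<close>

lemma subteam_intervene:
  assumes "consistent xs"
  shows "subteam \<sigma> (intervene \<sigma> T xs) \<gamma> = intervene \<sigma> (subteam \<sigma> T (CCf xs \<gamma>)) xs"
  using assms by (simp add: subteam_def intervene_def filter_mset_image_mset)

lemma pco_equiv_Imp_Imp: "pco_equiv \<sigma> (Imp \<alpha> (Imp \<beta> \<phi>)) (Imp (CAnd \<alpha> \<beta>) \<phi>)"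
  by (simp add: pco_equiv_def subteam_subteam)

text \<open>For inconsistent \<open>xs\<close> both sides hold trivially, the right one through its
  inner counterfactual.\<close>

lemma pco_equiv_Cf_Imp: "pco_equiv \<sigma> (Cf xs (Imp \<gamma> \<phi>)) (Imp (CCf xs \<gamma>) (Cf xs \<phi>))"
  by (simp add: pco_equiv_def subteam_intervene)

lemma pco_equiv_Cf_Cf:
  assumes "is_signature \<sigma>" "is_conjunction \<sigma> xs" "is_conjunction \<sigma> ys"
  obtains zs where "is_conjunction \<sigma> zs" "\<And>\<phi>. pco_equiv \<sigma> (Cf xs (Cf ys \<phi>)) (Cf zs \<phi>)"
proof -
  \<comment> \<open>Merging could discard the conflicting entries of \<open>xs\<close>, so the
    inconsistent cases are separate. There the inconsistent conjunction itself serves as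
    \<open>zs\<close>, making both sides trivially true.\<close>
  consider "\<not> consistent xs" | "\<not> consistent ys" | "consistent xs" "consistent ys" by blast
  then show thesis
  proof cases
    case 1
    then show thesis using that[OF assms(2)] by (simp add: pco_equiv_def)
  next
    case 2
    then show thesis using that[OF assms(3)] by (simp add: pco_equiv_def)
  next
    case 3
    then show thesis
      using that[OF is_conjunction_override[OF assms(2,3)]] intervene_intervene[OF assms(1) _ assms(2,3)]
      by (simp add: pco_equiv_def consistent_override)
  qed
qed

section \<open>Literals as probabilistic atoms, and a tautological antecedent\<close>

lemma prob_ge_1_iff:
  assumes "rows T \<noteq> {#}"
  shows "prob \<sigma> T \<alpha> \<ge> 1 \<longleftrightarrow> (\<forall>s\<in>#rows T. co_sat \<sigma> (T\<lparr>rows := {#s#}\<rparr>) \<alpha>)"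
proof -
  let ?P = "\<lambda>s. co_sat \<sigma> (T\<lparr>rows := {#s#}\<rparr>) \<alpha>"
  have pos: "size (rows T) > 0" using assms by (simp add: nonempty_has_size)
  have "prob \<sigma> T \<alpha> \<ge> 1 \<longleftrightarrow> size (rows T) \<le> size (filter_mset ?P (rows T))"
    using pos by (simp add: prob_def subteam_def)
  \<comment> \<open>A submultiset at least as large as the whole is the whole.\<close>
  also have "\<dots> \<longleftrightarrow> filter_mset ?P (rows T) = rows T"
    using mset_subset_size[of "filter_mset ?P (rows T)" "rows T"] multiset_filter_subset[of ?P "rows T"]
    by (cases "filter_mset ?P (rows T) = rows T") (simp_all add: subset_mset.less_le)
  also have "\<dots> \<longleftrightarrow> (\<forall>s\<in>#rows T. ?P s)" by (simp add: filter_mset_eq_conv)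
  finally show ?thesis .
qed

text \<open>On the empty team \<open>prob\<close> is 0 / 0 = 0, but the atom is true there by
  convention, matching the vacuous quantifier.\<close>

lemma pco_sat_PAtom_ge_1:
  "pco_sat \<sigma> T (PAtom \<alpha> Geq (Const 1)) \<longleftrightarrow>
     (\<forall>s\<in>#rows T. co_sat \<sigma> (T\<lparr>rows := {#s#}\<rparr>) \<alpha>)"
  by (cases "rows T = {#}") (simp_all add: prob_ge_1_iff)

lemma pco_equiv_Eq_PAtom: "pco_equiv \<sigma> (Eq Y y) (PAtom (CEq Y y) Geq (Const 1))"
  unfolding pco_equiv_def pco_sat_PAtom_ge_1 by simp

lemma pco_equiv_Neq_PAtom: "pco_equiv \<sigma> (Neq Y y) (PAtom (CNeq Y y) Geq (Const 1))"
  unfolding pco_equiv_def pco_sat_PAtom_ge_1 by simp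

lemma co_sat_CImp_refl: "co_sat \<sigma> (T\<lparr>rows := {#s#}\<rparr>) (CImp \<alpha> \<alpha>)"
  by (simp add: co_sat_empty)

text \<open>CO has no constant for truth. On a single row, \<open>CImp \<alpha> \<alpha>\<close>
  evaluates \<open>\<alpha>\<close> either on a row satisfying it or on the empty team, where every
  CO formula holds; so no row is filtered out.\<close>

lemma pco_equiv_Imp_refl: "pco_equiv \<sigma> \<phi> (Imp (CImp \<alpha> \<alpha>) \<phi>)"
proof -
  have "subteam \<sigma> T (CImp \<alpha> \<alpha>) = T" for T
    unfolding subteam_def by (simp only: co_sat_CImp_refl filter_mset_True) simp
  then show ?thesis by (simp add: pco_equiv_def)
qed

section \<open>Normal forms\<close>

text \<open>Only the Boolean-combination shape is carried through the induction; conditions (A) and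
  (B) are read off from it at the end.\<close>

definition has_normal_form :: "('v, 'd) signature \<Rightarrow> ('v, 'd) pco \<Rightarrow> bool" where
  "has_normal_form \<sigma> \<phi> \<longleftrightarrow>
     (\<exists>\<psi>. is_pco \<sigma> \<psi> \<and> pco_equiv \<sigma> \<phi> \<psi> \<and> boolean_combination is_basic_form \<psi>)"

lemma has_normal_form_cong:
  "pco_equiv \<sigma> \<phi> \<psi> \<Longrightarrow> has_normal_form \<sigma> \<psi> \<Longrightarrow> has_normal_form \<sigma> \<phi>"
  unfolding has_normal_form_def by (blast intro: pco_equiv_trans)

lemma has_normal_form_basic:
  "is_pco \<sigma> \<phi> \<Longrightarrow> is_basic_form \<phi> \<Longrightarrow> has_normal_form \<sigma> \<phi>"
  unfolding has_normal_form_def by (auto simp: pco_equiv_def intro: boolean_combination.base)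

lemma has_normal_form_And:
  "has_normal_form \<sigma> \<phi> \<Longrightarrow> has_normal_form \<sigma> \<psi> \<Longrightarrow> has_normal_form \<sigma> (And \<phi> \<psi>)"
  unfolding has_normal_form_def
  by (metis is_pco.simps(4) pco_equiv_And_cong boolean_combination.conj)

lemma has_normal_form_BOr:
  "has_normal_form \<sigma> \<phi> \<Longrightarrow> has_normal_form \<sigma> \<psi> \<Longrightarrow> has_normal_form \<sigma> (BOr \<phi> \<psi>)"
  unfolding has_normal_form_def
  by (metis is_pco.simps(5) pco_equiv_BOr_cong boolean_combination.disj)

lemma has_normal_form_PAtom:
  assumes "is_pco \<sigma> (PAtom \<alpha> r t)"
  shows "has_normal_form \<sigma> (PAtom \<alpha> r t)"
\<comment> \<open>The tautology is built from the event of the atom itself, so its well-formedness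
  comes with the assumption.\<close>
proof (rule has_normal_form_cong[OF pco_equiv_Imp_refl[of _ _ \<alpha>]])
  show "has_normal_form \<sigma> (Imp (CImp \<alpha> \<alpha>) (PAtom \<alpha> r t))"
    using assms by (intro has_normal_form_basic) (auto simp: is_basic_form_def)
qed

lemma has_normal_form_Imp_boolean_combination:
  assumes "is_co \<sigma> \<delta>" "boolean_combination is_basic_form \<psi>" "is_pco \<sigma> \<psi>"
  shows "has_normal_form \<sigma> (Imp \<delta> \<psi>)"
  using assms(2,3)
proof induction
  case (base \<phi>)
  \<comment> \<open>A basic form starting with an implication absorbs \<open>\<delta>\<close> into
    its antecedent; the remaining one, a counterfactual with an atom as consequent, takes
    \<open>\<delta>\<close> as a prefix and becomes the third basic form.\<close>
  have "(\<exists>\<gamma> \<chi>. \<phi> = Imp \<gamma> \<chi> \<and> is_basic_form (Imp (CAnd \<delta> \<gamma>) \<chi>)) \<or> is_basic_form (Imp \<delta> \<phi>)"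
    using base.hyps by (auto simp: is_basic_form_def)
  then consider (imp) \<gamma> \<chi> where "\<phi> = Imp \<gamma> \<chi>" "is_basic_form (Imp (CAnd \<delta> \<gamma>) \<chi>)"
    | (cf) "is_basic_form (Imp \<delta> \<phi>)" by blast
  then show ?case
  proof cases
    case imp
    have "has_normal_form \<sigma> (Imp (CAnd \<delta> \<gamma>) \<chi>)"
      using imp assms(1) base.prems by (intro has_normal_form_basic) auto
    with imp(1) show ?thesis using has_normal_form_cong[OF pco_equiv_Imp_Imp] by blast
  next
    case cf
    with assms(1) base.prems show ?thesis by (intro has_normal_form_basic) auto
  qed
next
  case (conj \<phi> \<psi>)
  have "pco_equiv \<sigma> (Imp \<delta> (And \<phi> \<psi>)) (And (Imp \<delta> \<phi>) (Imp \<delta> \<psi>))"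
    by (simp add: pco_equiv_def)
  with conj show ?case by (auto intro: has_normal_form_cong has_normal_form_And)
next
  case (disj \<phi> \<psi>)
  have "pco_equiv \<sigma> (Imp \<delta> (BOr \<phi> \<psi>)) (BOr (Imp \<delta> \<phi>) (Imp \<delta> \<psi>))"
    by (simp add: pco_equiv_def)
  with disj show ?case by (auto intro: has_normal_form_cong has_normal_form_BOr)
qed

lemma has_normal_form_Imp:
  assumes "is_co \<sigma> \<delta>" "has_normal_form \<sigma> \<phi>"
  shows "has_normal_form \<sigma> (Imp \<delta> \<phi>)"
  using assms has_normal_form_Imp_boolean_combination[OF assms(1)]
  by (metis has_normal_form_def[of _ \<phi>] has_normal_form_cong pco_equiv_Imp_cong)

lemma has_normal_form_Cf_boolean_combination:
  assumes sig: "is_signature \<sigma>" and xs: "is_conjunction \<sigma> xs"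
    and "boolean_combination is_basic_form \<psi>" "is_pco \<sigma> \<psi>"
  shows "has_normal_form \<sigma> (Cf xs \<psi>)"
  using assms(3,4)
proof induction
  case (base \<phi>)
  have atom: "has_normal_form \<sigma> (Cf xs (PAtom \<alpha> r t))" if "is_pco \<sigma> (PAtom \<alpha> r t)" for \<alpha> r t
    using that xs by (intro has_normal_form_basic) (auto simp: is_basic_form_def)
  have cf: "has_normal_form \<sigma> (Cf xs (Cf ys (PAtom \<alpha> r t)))"
    if wf: "is_pco \<sigma> (Cf ys (PAtom \<alpha> r t))" for ys \<alpha> r t
  proof -
    from wf have ys: "is_conjunction \<sigma> ys" by simp
    obtain zs where zs: "is_conjunction \<sigma> zs" "\<And>\<phi>. pco_equiv \<sigma> (Cf xs (Cf ys \<phi>)) (Cf zs \<phi>)"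
      using pco_equiv_Cf_Cf[OF sig xs ys] by blast
    have "has_normal_form \<sigma> (Cf zs (PAtom \<alpha> r t))"
      using wf zs(1) by (intro has_normal_form_basic) (auto simp: is_basic_form_def)
    with zs(2) show ?thesis by (rule has_normal_form_cong)
  qed
  \<comment> \<open>The counterfactual moves past the implication, so normalizing
    \<open>Cf xs \<chi>\<close> suffices and the result for \<open>Imp\<close> does the
    rest.\<close>
  have imp: "has_normal_form \<sigma> (Cf xs (Imp \<gamma> \<chi>))"
    if "is_co \<sigma> \<gamma>" "has_normal_form \<sigma> (Cf xs \<chi>)" for \<gamma> \<chi>
    using that xs by (intro has_normal_form_cong[OF pco_equiv_Cf_Imp] has_normal_form_Imp) auto
  from base.hyps show ?case
    unfolding is_basic_form_def using base.prems by (elim disjE exE) (auto intro!: atom cf imp)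
next
  case (conj \<phi> \<psi>)
  have "pco_equiv \<sigma> (Cf xs (And \<phi> \<psi>)) (And (Cf xs \<phi>) (Cf xs \<psi>))"
    by (auto simp: pco_equiv_def)
  with conj show ?case by (auto intro: has_normal_form_cong has_normal_form_And)
next
  case (disj \<phi> \<psi>)
  have "pco_equiv \<sigma> (Cf xs (BOr \<phi> \<psi>)) (BOr (Cf xs \<phi>) (Cf xs \<psi>))"
    by (auto simp: pco_equiv_def)
  with disj show ?case by (auto intro: has_normal_form_cong has_normal_form_BOr)
qed

lemma has_normal_form_Cf:
  assumes "is_signature \<sigma>" "is_conjunction \<sigma> xs" "has_normal_form \<sigma> \<phi>"
  shows "has_normal_form \<sigma> (Cf xs \<phi>)"
  using assms has_normal_form_Cf_boolean_combination[OF assms(1,2)]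
  by (metis has_normal_form_def[of _ \<phi>] has_normal_form_cong pco_equiv_Cf_cong)

lemma has_normal_form_pco:
  assumes "is_signature \<sigma>" "is_pco \<sigma> \<phi>"
  shows "has_normal_form \<sigma> \<phi>"
  using assms(2)
proof (induction \<phi>)
  case (Eq Y y)
  then show ?case
    by (intro has_normal_form_cong[OF pco_equiv_Eq_PAtom] has_normal_form_PAtom) simp
next
  case (Neq Y y)
  then show ?case
    by (intro has_normal_form_cong[OF pco_equiv_Neq_PAtom] has_normal_form_PAtom) simp
qed (use assms(1) in \<open>auto intro: has_normal_form_PAtom has_normal_form_And has_normal_form_BOr
      has_normal_form_Imp has_normal_form_Cf\<close>)

text \<open>Conjunction and Boolean disjunction create no new conditional subformulas, so only the
  three basic forms need inspection.\<close>

lemma boolean_combination_cf_consequents: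
  "boolean_combination is_basic_form \<psi> \<Longrightarrow> cf_consequents_prob_atoms \<psi>"
  by (induction rule: boolean_combination.induct)
    (auto simp: cf_consequents_prob_atoms_def is_basic_form_def is_prob_atom_def)

lemma boolean_combination_imp_consequents:
  "boolean_combination is_basic_form \<psi> \<Longrightarrow> imp_consequents_cf_or_prob_atoms \<psi>"
  by (induction rule: boolean_combination.induct)
    (auto simp: imp_consequents_cf_or_prob_atoms_def is_basic_form_def is_prob_atom_def
      is_counterfactual_def)

theorem mainTheorem2:
  fixes \<sigma> :: "('v, 'd) signature" and \<phi> :: "('v, 'd) pco"
  assumes "is_signature \<sigma>" and "is_pco \<sigma> \<phi>"
  shows "(\<exists>\<phi>'. is_pco \<sigma> \<phi>' \<and> pco_equiv \<sigma> \<phi> \<phi>' \<and>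
                cf_consequents_prob_atoms \<phi>' \<and> imp_consequents_cf_or_prob_atoms \<phi>') \<and>
         (\<exists>\<phi>''. is_pco \<sigma> \<phi>'' \<and> pco_equiv \<sigma> \<phi> \<phi>'' \<and>
                boolean_combination is_basic_form \<phi>'')"
  \<comment> \<open>One formula witnesses both existential claims.\<close>
  using has_normal_form_pco[OF assms] unfolding has_normal_form_def
  by (blast intro: boolean_combination_cf_consequents boolean_combination_imp_consequents)

end
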